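(* For each $e\ge 3$ and $k,l\in\{0,1\}$, the automorphism group $\mathrm{Aut}\,G_2(e;k,l)$ has order $2^{4e-3}$ if $l=0$, and order $2^{4e-4}$ if $l=1$.
   Context: Conventions: $x^y=y^{-1}xy$ and $[x,y]=x^{-1}y^{-1}xy$. For $n=2^e\ge 8$ and $k,l\in\{0,1\}$, $$G_2(e;k,l)=\langle a,b\mid a^n=b^n=[b^2,a^2]=1,\ [b,a]=a^2b^{-2}(a^{n/2}b^{n/2})^k,\ (b^2)^a=b^{-2}(a^{n/2}b^{n/2})^l,\ (a^2)^b=a^{-2}(a^{n/2}b^{n/2})^l\rangle .$$ *)

theory Defs
  imports "HOL-Algebra.Coset" "HOL-Algebra.Bij"
begin

section \<open>Groups given by generators and relations\<close>

text \<open>A letter \<open>(x, True)\<close> is the generator \<open>x\<close>, and \<open>(x, False)\<close> is its formal inverse.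
  Words need not be reduced: free cancellation is one of the rules of \<open>pres_cong\<close>.\<close>

type_synonym 'g word = "('g \<times> bool) list"

definition word_gen :: "'g \<Rightarrow> 'g word" where
  "word_gen x = [(x, True)]"

definition word_inv :: "'g word \<Rightarrow> 'g word" where
  "word_inv w = rev (map (\<lambda>(x, s). (x, \<not> s)) w)"

definition word_pow :: "'g word \<Rightarrow> nat \<Rightarrow> 'g word" where
  "word_pow w m = concat (replicate m w)"

text \<open>Conventions: \<open>x\<^sup>y = y\<^sup>-\<^sup>1 x y\<close> and \<open>[x, y] = x\<^sup>-\<^sup>1 y\<^sup>-\<^sup>1 x y\<close>.\<close>

definition word_conj :: "'g word \<Rightarrow> 'g word \<Rightarrow> 'g word" where
  "word_conj u v = word_inv v @ u @ v"

definition word_comm :: "'g word \<Rightarrow> 'g word \<Rightarrow> 'g word" where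
  "word_comm u v = word_inv u @ word_inv v @ u @ v"

text \<open>A relation \<open>u = v\<close> is the pair \<open>(u, v)\<close>.  The group presented by a set of relations is
  the set of all words modulo the least congruence containing the relations and free cancellation.\<close>

inductive pres_cong :: "('g word \<times> 'g word) set \<Rightarrow> 'g word \<Rightarrow> 'g word \<Rightarrow> bool"
  for R :: "('g word \<times> 'g word) set" where
  refl: "pres_cong R w w"
| sym: "pres_cong R u v \<Longrightarrow> pres_cong R v u"
| trans: "pres_cong R u v \<Longrightarrow> pres_cong R v w \<Longrightarrow> pres_cong R u w"
| append: "pres_cong R u u' \<Longrightarrow> pres_cong R v v' \<Longrightarrow> pres_cong R (u @ v) (u' @ v')"
| cancel: "pres_cong R [(x, s), (x, \<not> s)] []"
| relation: "(u, v) \<in> R \<Longrightarrow> pres_cong R u v"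

definition pres_rel :: "('g word \<times> 'g word) set \<Rightarrow> ('g word \<times> 'g word) set" where
  "pres_rel R = {(u, v). pres_cong R u v}"

definition presented_group :: "('g word \<times> 'g word) set \<Rightarrow> 'g word set monoid" where
  "presented_group R =
    \<lparr>carrier = UNIV // pres_rel R,
     mult = (\<lambda>X Y. \<Union>u\<in>X. \<Union>v\<in>Y. pres_rel R `` {u @ v}),
     one = pres_rel R `` {[]}\<rparr>"

lemma equiv_pres_rel: "equiv UNIV (pres_rel R)"
  by (rule equivI)
     (auto simp: pres_rel_def intro!: refl_onI symI transI intro: pres_cong.intros)

lemma pres_class_eq_iff: "pres_rel R `` {u} = pres_rel R `` {v} \<longleftrightarrow> pres_cong R u v"
  using eq_equiv_class_iff[OF equiv_pres_rel, of u v R] by (simp add: pres_rel_def)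

lemma presented_group_carrier:
  "X \<in> carrier (presented_group R) \<longleftrightarrow> (\<exists>u. X = pres_rel R `` {u})"
  by (auto simp: presented_group_def quotient_def)

lemma presented_group_one: "\<one>\<^bsub>presented_group R\<^esub> = pres_rel R `` {[]}"
  by (simp add: presented_group_def)

lemma presented_group_mult:
  "pres_rel R `` {u} \<otimes>\<^bsub>presented_group R\<^esub> pres_rel R `` {v} = pres_rel R `` {u @ v}"
proof -
  have "congruent2 (pres_rel R) (pres_rel R) (\<lambda>u v. pres_rel R `` {u @ v})"
    by (rule congruent2I') (simp add: pres_class_eq_iff, simp add: pres_rel_def pres_cong.append)
  then show ?thesis
    by (simp add: presented_group_def UN_equiv_class2[OF equiv_pres_rel equiv_pres_rel])
qed

lemma pres_cong_word_inv_left: "pres_cong R (word_inv w @ w) []"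
proof (induction w)
  case Nil
  show ?case by (simp add: word_inv_def pres_cong.refl)
next
  case (Cons a w)
  obtain x s where a: "a = (x, s)" by (cases a)
  have "pres_cong R [(x, \<not> s), (x, s)] []"
    using pres_cong.cancel[of R x "\<not> s"] by simp
  then have "pres_cong R (word_inv w @ [(x, \<not> s), (x, s)] @ w) (word_inv w @ [] @ w)"
    by (intro pres_cong.append pres_cong.refl)
  then have "pres_cong R (word_inv (a # w) @ a # w) (word_inv w @ w)"
    by (simp add: a word_inv_def)
  then show ?case using Cons.IH by (rule pres_cong.trans)
qed

theorem group_presented_group: "group (presented_group R)"
proof (rule groupI)
  fix X assume "X \<in> carrier (presented_group R)"
  then obtain u where u: "X = pres_rel R `` {u}" by (auto simp: presented_group_carrier)
  have "pres_rel R `` {word_inv u} \<otimes>\<^bsub>presented_group R\<^esub> X = \<one>\<^bsub>presented_group R\<^esub>"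
    by (simp add: u presented_group_mult presented_group_one pres_class_eq_iff
        pres_cong_word_inv_left)
  then show "\<exists>Y\<in>carrier (presented_group R). Y \<otimes>\<^bsub>presented_group R\<^esub> X = \<one>\<^bsub>presented_group R\<^esub>"
    using presented_group_carrier by blast
qed (auto simp: presented_group_carrier presented_group_mult presented_group_one)

text \<open>The universal property of the presentation.\<close>

definition word_eval :: "('a, 'b) monoid_scheme \<Rightarrow> ('g \<Rightarrow> 'a) \<Rightarrow> 'g word \<Rightarrow> 'a" where
  "word_eval H f w =
     foldr (\<lambda>(x, s) y. (if s then f x else inv\<^bsub>H\<^esub> f x) \<otimes>\<^bsub>H\<^esub> y) w \<one>\<^bsub>H\<^esub>"

lemma (in group) word_eval_closed:
  assumes "\<And>x. f x \<in> carrier G" shows "word_eval G f w \<in> carrier G"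
  by (induction w) (auto simp: word_eval_def assms)

lemma (in group) word_eval_append:
  assumes "\<And>x. f x \<in> carrier G"
  shows "word_eval G f (u @ v) = word_eval G f u \<otimes> word_eval G f v"
proof (induction u)
  case Nil
  have "word_eval G f [] = \<one>" by (simp add: word_eval_def)
  then show ?case using word_eval_closed[of f v, OF assms] by simp
next
  case (Cons a u)
  obtain x s where a: "a = (x, s)" by (cases a)
  have step: "word_eval G f (a # w) = (if s then f x else inv f x) \<otimes> word_eval G f w" for w
    by (simp add: word_eval_def a)
  show ?case
    using Cons.IH word_eval_closed[of f u, OF assms] word_eval_closed[of f v, OF assms] assms[of x]
    by (simp add: step m_assoc)
qed

lemma (in group) word_eval_pres_cong:
  assumes f: "\<And>x. f x \<in> carrier G"
    and R: "\<And>u v. (u, v) \<in> R \<Longrightarrow> word_eval G f u = word_eval G f v"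
    and "pres_cong R u v"
  shows "word_eval G f u = word_eval G f v"
  using assms(3)
proof induction
  case (cancel x s)
  then show ?case using f[of x] by (simp add: word_eval_def)
qed (simp_all add: R word_eval_append[OF f])

theorem (in group) presented_group_hom_exists:
  assumes f: "\<And>x. f x \<in> carrier G"
    and R: "\<And>u v. (u, v) \<in> R \<Longrightarrow> word_eval G f u = word_eval G f v"
  shows "\<exists>h \<in> hom (presented_group R) G. \<forall>w. h (pres_rel R `` {w}) = word_eval G f w"
proof -
  define h where "h X = word_eval G f (SOME w. X = pres_rel R `` {w})" for X
  have h: "h (pres_rel R `` {w}) = word_eval G f w" for w
  proof -
    have "pres_rel R `` {w} = pres_rel R `` {SOME v. pres_rel R `` {w} = pres_rel R `` {v}}"
      by (rule someI[of _ w]) simp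
    then have "pres_cong R w (SOME v. pres_rel R `` {w} = pres_rel R `` {v})"
      by (simp only: pres_class_eq_iff)
    from word_eval_pres_cong[OF f R this] show ?thesis
      by (simp add: h_def)
  qed
  have "h \<in> hom (presented_group R) G"
    by (rule homI) (auto simp: presented_group_carrier presented_group_mult h
        word_eval_append[OF f] word_eval_closed[OF f])
  with h show ?thesis by blast
qed


section \<open>The groups \<open>G\<^sub>2(e; k, l)\<close>\<close>

datatype gen = gen_a | gen_b

definition G2_relations :: "nat \<Rightarrow> nat \<Rightarrow> nat \<Rightarrow> (gen word \<times> gen word) set" where
  "G2_relations e k l =
    (let n = 2 ^ e;
         a = word_gen gen_a;
         b = word_gen gen_b;
         a2 = word_pow a 2;
         b2 = word_pow b 2;
         z = word_pow a (n div 2) @ word_pow b (n div 2)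
     in {(word_pow a n, []),
         (word_pow b n, []),
         (word_comm b2 a2, []),
         (word_comm b a, a2 @ word_inv b2 @ word_pow z k),
         (word_conj b2 a, word_inv b2 @ word_pow z l),
         (word_conj a2 b, word_inv a2 @ word_pow z l)})"

definition G2 :: "nat \<Rightarrow> nat \<Rightarrow> nat \<Rightarrow> gen word set monoid" where
  "G2 e k l = presented_group (G2_relations e k l)"

end

theory Submission
  imports Defs
begin

text \<open>
  Put \<open>g = 2\<^sup>e\<^sup>-\<^sup>3\<close>, so that \<open>n = 8g\<close>. The subgroup \<open>N = \<langle>a\<^sup>2, b\<^sup>2\<rangle>\<close> is abelian, isomorphic to
  \<open>(\<int>/4g)\<^sup>2\<close>, and has cosets \<open>N, aN, bN, abN\<close>. It consists of the elements that commute with all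
  squares, so it is characteristic; elements of \<open>abN\<close> have order dividing 4 while \<open>a\<close> and \<open>b\<close> have
  order \<open>n\<close>. Hence an automorphism either fixes both \<open>aN\<close> and \<open>bN\<close> or exchanges them, and exchanging
  \<open>a\<close> and \<open>b\<close> is an automorphism because the relations are symmetric in \<open>a\<close> and \<open>b\<close>. The pair
  \<open>(a a\<^sup>2\<^sup>p b\<^sup>2\<^sup>q, b a\<^sup>2\<^sup>r b\<^sup>2\<^sup>s)\<close> satisfies the relations iff \<open>l (p + q + r + s)\<close> is even, which leaves
  \<open>(4g)\<^sup>4\<close> pairs for \<open>l = 0\<close> and half as many for \<open>l = 1\<close>.
  That \<open>N\<close> is no smaller is seen from an action of words on \<open>\<int>\<^sup>2 \<times> {0, 1}\<^sup>2\<close> modulo \<open>4g\<close>.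
\<close>

section \<open>Monomials in two squares\<close>

definition sqmon :: "('a, 'c) monoid_scheme \<Rightarrow> 'a \<Rightarrow> 'a \<Rightarrow> int \<Rightarrow> int \<Rightarrow> 'a" where
  "sqmon G a b x y = (a \<otimes>\<^bsub>G\<^esub> a) [^]\<^bsub>G\<^esub> x \<otimes>\<^bsub>G\<^esub> (b \<otimes>\<^bsub>G\<^esub> b) [^]\<^bsub>G\<^esub> y"

text \<open>Induction gives natural powers, inversion the negative ones. With \<open>c\<close> a
  generator this extends a conjugation relation to all powers; with \<open>u = v\<close> it passes
  from commuting elements to commuting powers.\<close>

lemma (in group) int_pow_intertwine:
  assumes c: "u \<in> carrier G" "v \<in> carrier G" "c \<in> carrier G" and eq: "u \<otimes> c = c \<otimes> v"
  shows "u [^] (i::int) \<otimes> c = c \<otimes> v [^] i"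
proof -
  have n: "u [^] n \<otimes> c = c \<otimes> v [^] n" for n :: nat
  proof (induction n)
    case (Suc n)
    have "u [^] Suc n \<otimes> c = u [^] n \<otimes> c \<otimes> v" using c eq by (simp add: m_assoc)
    then show ?case using c Suc by (simp add: m_assoc)
  qed (use c in simp)
  have "inv (u [^] n) \<otimes> c = c \<otimes> inv (v [^] n)" for n :: nat
  proof -
    have "u [^] n \<in> carrier G" "v [^] n \<in> carrier G" using c by simp_all
    note c = c this
    have "c = inv (u [^] n) \<otimes> (c \<otimes> v [^] n)"
      by (rule iffD2[OF inv_solve_left]) (use c n[of n] in auto)
    then have "c = (inv (u [^] n) \<otimes> c) \<otimes> v [^] n"
      using c by (simp only: m_assoc inv_closed)
    then show ?thesis
      by (intro iffD2[OF inv_solve_right]) (use c in auto)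
  qed
  with n show ?thesis unfolding int_pow_def2 by presburger
qed

section \<open>Pairs satisfying the relations\<close>

text \<open>Split off from the other relations because it is what makes monomials multiply by adding
  exponents; the other word relations can be rewritten in monomials only once it is known.\<close>

locale commuting_squares = group G for G (structure) +
  fixes a b
  assumes a_closed [simp, intro]: "a \<in> carrier G"
    and b_closed [simp, intro]: "b \<in> carrier G"
    and squares_commute: "(a \<otimes> a) \<otimes> (b \<otimes> b) = (b \<otimes> b) \<otimes> (a \<otimes> a)"
begin

text \<open>\<open>sqmon\<close> itself keeps the pair as arguments because it is also applied to
  translated and exchanged pairs and to images under homomorphisms.\<close>

abbreviation E :: "int \<Rightarrow> int \<Rightarrow> 'a" where "E \<equiv> sqmon G a b"

lemma E_closed [simp, intro]: "E x y \<in> carrier G"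
  by (simp add: sqmon_def)

lemma E_0 [simp]: "E 0 0 = \<one>"
  by (simp add: sqmon_def)

lemma aa: "a \<otimes> a = E 1 0" and bb: "b \<otimes> b = E 0 1"
  by (simp_all add: sqmon_def)

lemma E_mult: "E x y \<otimes> E x' y' = E (x + x') (y + y')"
proof -
  let ?u = "a \<otimes> a" and ?v = "b \<otimes> b"
  have "?v [^] y \<otimes> ?u [^] x' = ?u [^] x' \<otimes> ?v [^] y"
    by (intro int_pow_intertwine int_pow_intertwine[symmetric]) (simp_all add: squares_commute)
  then have "?u [^] x \<otimes> (?v [^] y \<otimes> ?u [^] x') \<otimes> ?v [^] y' = ?u [^] x \<otimes> (?u [^] x' \<otimes> ?v [^] y) \<otimes> ?v [^] y'"
    by simp
  then show ?thesis
    by (simp add: sqmon_def int_pow_mult m_assoc)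
qed

lemma E_commute: "E x y \<otimes> E x' y' = E x' y' \<otimes> E x y"
  by (simp add: E_mult add.commute)

lemma E_inv: "inv (E x y) = E (- x) (- y)"
  by (rule inv_equality) (simp_all add: E_mult)

lemma E_pow: "E x y [^] i = E (x * i) (y * i)" for i :: int
proof -
  let ?u = "a \<otimes> a" and ?v = "b \<otimes> b"
  have "?u [^] x \<otimes> ?v [^] y = ?v [^] y \<otimes> ?u [^] x"
    using E_commute[of x 0 0 y] by (simp add: sqmon_def)
  then have "E x y [^] i = (?u [^] x) [^] i \<otimes> (?v [^] y) [^] i"
    unfolding sqmon_def by (intro int_pow_mult_distrib) simp_all
  then show ?thesis
    by (simp only: sqmon_def int_pow_pow m_closed a_closed b_closed)
qed

end

text \<open>The relations for n = 8g, solved for the order \<open>a\<close>, \<open>b\<close>,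
  squares. Here a^n is the 4g-th power of a^2, and a^(n/2) b^(n/2) is the monomial z =
  \<open>E (2 * g) (2 * g)\<close>.\<close>

locale G2_pair = commuting_squares G a b for G (structure) and a b +
  fixes g k l :: int
  assumes a_order: "sqmon G a b (4 * g) 0 = \<one>"
    and b_order: "sqmon G a b 0 (4 * g) = \<one>"
    and b_a: "b \<otimes> a = a \<otimes> b \<otimes> sqmon G a b (1 + 2 * g * k) (2 * g * k - 1)"
    and bb_a: "b \<otimes> b \<otimes> a = a \<otimes> sqmon G a b (2 * g * l) (2 * g * l - 1)"
    and aa_b: "a \<otimes> a \<otimes> b = b \<otimes> sqmon G a b (2 * g * l - 1) (2 * g * l)"
begin

lemma E_cong:
  assumes "4 * g dvd x - x'" "4 * g dvd y - y'"
  shows "E x y = E x' y'"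
proof -
  obtain i j where ij: "x = x' + 4 * g * i" "y = y' + 4 * g * j"
    using assms by (metis dvdE diff_eq_eq add.commute)
  have "E (4 * g * i) 0 = E (4 * g) 0 [^] i" "E 0 (4 * g * j) = E 0 (4 * g) [^] j"
    by (simp_all only: E_pow mult_zero_left)
  then have "E (4 * g * i) 0 = \<one>" "E 0 (4 * g * j) = \<one>"
    by (simp_all only: a_order b_order int_pow_one)
  then show ?thesis
    using E_mult[of x' y' "4*g*i" 0] E_mult[of "x' + 4*g*i" y' 0 "4*g*j"] by (simp add: ij)
qed

lemma E_one: "4 * g dvd x \<Longrightarrow> 4 * g dvd y \<Longrightarrow> E x y = \<one>"
  using E_cong[of x 0 y 0] by simp

lemma E_a: "E x y \<otimes> a = a \<otimes> E (x + 2 * g * l * y) (2 * g * l * y - y)"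
proof -
  have "(b \<otimes> b) [^] y \<otimes> a = a \<otimes> E (2 * g * l) (2 * g * l - 1) [^] y"
    by (rule int_pow_intertwine) (simp_all add: bb_a)
  moreover have "(a \<otimes> a) [^] x \<otimes> a = a \<otimes> (a \<otimes> a) [^] x"
    by (rule int_pow_intertwine) (simp_all add: m_assoc)
  ultimately have "E x y \<otimes> a = a \<otimes> (E x 0 \<otimes> E (2 * g * l) (2 * g * l - 1) [^] y)"
    by (simp add: sqmon_def m_assoc flip: m_assoc[of _ a])
  then show ?thesis by (simp add: E_pow E_mult algebra_simps)
qed

lemma E_b: "E x y \<otimes> b = b \<otimes> E (2 * g * l * x - x) (y + 2 * g * l * x)"
proof -
  have "(a \<otimes> a) [^] x \<otimes> b = b \<otimes> E (2 * g * l - 1) (2 * g * l) [^] x"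
    by (rule int_pow_intertwine) (simp_all add: aa_b)
  moreover have "(b \<otimes> b) [^] y \<otimes> b = b \<otimes> (b \<otimes> b) [^] y"
    by (rule int_pow_intertwine) (simp_all add: m_assoc)
  \<comment> \<open>The powers of a^2 are put last, next to the \<open>b\<close> that they cross
    first.\<close>
  moreover have "E x y = E 0 y \<otimes> E x 0" by (simp add: E_mult)
  ultimately have "E x y \<otimes> b = b \<otimes> (E 0 y \<otimes> E (2 * g * l - 1) (2 * g * l) [^] x)"
    by (simp add: sqmon_def m_assoc flip: m_assoc[of _ b])
  then show ?thesis by (simp add: E_pow E_mult algebra_simps)
qed

text \<open>In right-nested products a rule for \<open>u \<otimes> v\<close> does not match inside
  \<open>u \<otimes> (v \<otimes> c)\<close>; this form lets every collecting rule act there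
  too.\<close>

lemma left_extend:
  assumes "u \<otimes> v = w" "u \<in> carrier G" "v \<in> carrier G" "c \<in> carrier G"
  shows "u \<otimes> (v \<otimes> c) = w \<otimes> c"
  using assms by (auto simp: m_assoc)

text \<open>Rewriting with these facts brings a product of \<open>a\<close>, \<open>b\<close> and terms \<open>E x y\<close> into the form
  \<open>a\<^sup>s b\<^sup>t E x y\<close>.\<close>

lemmas collect =
  m_assoc aa bb E_mult E_a E_b b_a
  left_extend[OF aa] left_extend[OF bb] left_extend[OF E_mult]
  left_extend[OF E_a] left_extend[OF E_b] left_extend[OF b_a]

text \<open>The two conjugation relations trade places. Solving the relation for
  \<open>b \<otimes> a\<close> for \<open>a \<otimes> b\<close> interchanges its exponents, because
  \<open>E (4 * g * k) (4 * g * k)\<close> is trivial.\<close>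

lemma swap: "G2_pair G b a g k l"
proof -
  have sw: "sqmon G b a x y = E y x" for x y
    using E_commute[of 0 x y 0] by (simp add: sqmon_def)
  have "a \<otimes> b = b \<otimes> a \<otimes> E (2 * g * k - 1) (1 + 2 * g * k)"
    by (simp add: collect) (intro arg_cong2[of _ _ _ _ "(\<otimes>)"] HOL.refl E_cong E_one; algebra)
  then show ?thesis
    using a_order b_order aa_b bb_a squares_commute by unfold_locales (simp_all add: sw)
qed

section \<open>Translated pairs\<close>

context
  fixes p q r s :: int and A B
  assumes A_def: "A = a \<otimes> E p q" and B_def: "B = b \<otimes> E r s"
begin

text \<open>Conjugation by \<open>a\<close> inverts b^2 up to z^l, so \<open>q\<close> drops out of
  A^2 except for the factor z^(lq); likewise \<open>r\<close> in B^2. The exponents thus undergo a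
  linear substitution whose matrix has odd diagonal and off-diagonal entries divisible by
  2g.\<close>

lemma sqmon_translate:
  "sqmon G A B x y =
    E (x * (1 + 2 * p + 2 * g * l * q) + y * (2 * g * l * r))
      (x * (2 * g * l * q) + y * (1 + 2 * s + 2 * g * l * r))"
proof -
  have "A \<otimes> A = E (1 + 2 * p + 2 * g * l * q) (2 * g * l * q)"
    by (simp add: A_def B_def collect algebra_simps)
  moreover have "B \<otimes> B = E (2 * g * l * r) (1 + 2 * s + 2 * g * l * r)"
    by (simp add: A_def B_def collect algebra_simps)
  ultimately show ?thesis
    by (simp only: sqmon_def[of G A B]) (simp add: E_pow E_mult algebra_simps)
qed

text \<open>After collection the two sides differ exactly by z^(l(p+q+r+s)). This is the source of
  the parity condition.\<close>

lemma BA_relation: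
  "B \<otimes> A = A \<otimes> B \<otimes> sqmon G A B (1 + 2 * g * k) (2 * g * k - 1) \<longleftrightarrow>
    E (2 * g * l * (p + q + r + s)) (2 * g * l * (p + q + r + s)) = \<one>"
proof -
  let ?d = "2 * g * l * (p + q + r + s)"
  have "B \<otimes> A = a \<otimes> b \<otimes> E (1 + 2 * g * k + (r + 2 * g * l * s) + p) (2 * g * k - 1 + (2 * g * l * s - s) + q)"
    by (simp add: A_def B_def collect algebra_simps)
  moreover have "A \<otimes> B \<otimes> sqmon G A B (1 + 2 * g * k) (2 * g * k - 1) \<otimes> E ?d ?d
     = a \<otimes> b \<otimes> E (1 + 2 * g * k + (r + 2 * g * l * s) + p) (2 * g * k - 1 + (2 * g * l * s - s) + q)"
    unfolding sqmon_translate
    by (simp add: A_def B_def collect) (intro arg_cong2[of _ _ _ _ "(\<otimes>)"] HOL.refl E_cong E_one; algebra)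
  ultimately have "B \<otimes> A = A \<otimes> B \<otimes> sqmon G A B (1 + 2 * g * k) (2 * g * k - 1) \<otimes> E ?d ?d"
    by simp
  then show ?thesis
    unfolding sqmon_translate by (simp add: A_def B_def)
qed

text \<open>The parity makes 2gl(p+q+r+s) a multiple of 4g, as \<open>BA_relation\<close> demands;
  the other relations become congruences modulo 4g between exponents.\<close>

lemma translate_pair:
  assumes "even (l * (p + q + r + s))"
  shows "G2_pair G A B g k l"
proof -
  from assms obtain c where c: "l * (p + q + r + s) = 2 * c" by (rule evenE)
  have "2 * g * l * (p + q + r + s) = 4 * g * c"
    unfolding mult.assoc[of "2 * g"] c by simp
  then have "4 * g dvd 2 * g * l * (p + q + r + s)" by (metis dvd_triv_left)
  then have "E (2 * g * l * (p + q + r + s)) (2 * g * l * (p + q + r + s)) = E 0 0"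
    by (intro E_cong) simp_all
  then have BA: "B \<otimes> A = A \<otimes> B \<otimes> sqmon G A B (1 + 2 * g * k) (2 * g * k - 1)"
    unfolding BA_relation by simp
  have sq: "A \<otimes> A = sqmon G A B 1 0" "B \<otimes> B = sqmon G A B 0 1"
    by (simp_all add: sqmon_def A_def B_def)
  show ?thesis
  proof unfold_locales
    show "A \<otimes> A \<otimes> (B \<otimes> B) = B \<otimes> B \<otimes> (A \<otimes> A)"
      unfolding sq sqmon_translate by (rule E_commute)
    show "sqmon G A B (4 * g) 0 = \<one>" "sqmon G A B 0 (4 * g) = \<one>"
      unfolding sqmon_translate by (rule E_one; algebra)+
    show "B \<otimes> B \<otimes> A = A \<otimes> sqmon G A B (2 * g * l) (2 * g * l - 1)"
      unfolding sq sqmon_translate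
      by (simp add: A_def B_def collect) (intro arg_cong2[of _ _ _ _ "(\<otimes>)"] HOL.refl E_cong E_one; algebra)
    show "A \<otimes> A \<otimes> B = B \<otimes> sqmon G A B (2 * g * l - 1) (2 * g * l)"
      unfolding sq sqmon_translate
      by (simp add: A_def B_def collect) (intro arg_cong2[of _ _ _ _ "(\<otimes>)"] HOL.refl E_cong E_one; algebra)
  qed (use BA in \<open>simp_all add: A_def B_def\<close>)
qed

end

end

lemma hom_sqmon:
  assumes "group G" "group H" "\<phi> \<in> hom G H" "a \<in> carrier G" "b \<in> carrier G"
  shows "\<phi> (sqmon G a b x y) = sqmon H (\<phi> a) (\<phi> b) x y"
proof -
  interpret group_hom G H \<phi> using assms by (simp add: group_hom_def group_hom_axioms_def)
  show ?thesis using assms(4,5) by (simp only: sqmon_def hom_mult hom_int_pow G.m_closed G.int_pow_closed)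
qed

text \<open>Homomorphisms preserve equations between words. Applied to an automorphism, this yields
  the parity condition on the images of the generators.\<close>

lemma G2_pair_hom:
  assumes "G2_pair G a b g k l" "group H" and \<phi>: "\<phi> \<in> hom G H"
  shows "G2_pair H (\<phi> a) (\<phi> b) g k l"
proof -
  interpret G2_pair G a b g k l by fact
  interpret H: group H by fact
  interpret group_hom G H \<phi> using \<phi> by unfold_locales
  note E = hom_sqmon[OF is_group H.is_group \<phi> a_closed b_closed, symmetric]
  show ?thesis
    by unfold_locales
      (simp_all only: E hom_mult[symmetric] hom_one a_closed b_closed m_closed E_closed hom_closed
        squares_commute a_order b_order b_a bb_a aa_b)
qed

section \<open>Automorphisms\<close>

text \<open>What the count uses of the presented group: generation, as an induction over letters
  multiplied from the left; N of full size with four distinct cosets; and the universal property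
  \<open>extends\<close>.\<close>

locale G2_group = G2_pair +
  assumes g_power: "\<exists>j. g = 2 ^ j"
    and generated: "\<lbrakk>\<one> \<in> S; \<And>x. x \<in> S \<Longrightarrow> a \<otimes> x \<in> S \<and> inv a \<otimes> x \<in> S \<and> b \<otimes> x \<in> S \<and> inv b \<otimes> x \<in> S\<rbrakk>
      \<Longrightarrow> carrier G \<subseteq> S"
    and E_eq_one: "E x y = \<one> \<Longrightarrow> 4 * g dvd x \<and> 4 * g dvd y"
    and a_neq_E: "a \<noteq> E x y" and b_neq_E: "b \<noteq> E x y" and ab_neq_E: "a \<otimes> b \<noteq> E x y"
    and extends: "G2_pair G a' b' g k l \<Longrightarrow> \<exists>\<phi>\<in>hom G G. \<phi> a = a' \<and> \<phi> b = b'"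
begin

section \<open>Divisibility by powers of two\<close>

lemma g_pos: "0 < g"
  using g_power by auto

lemma dvd_mult_odd_iff:
  assumes "odd c"
  shows "4 * g dvd x * c \<longleftrightarrow> 4 * g dvd x" "2 * g dvd x * c \<longleftrightarrow> 2 * g dvd x"
proof -
  obtain j where j: "g = 2 ^ j" using g_power by blast
  have "4 * g = 2 ^ (j + 2)" "2 * g = 2 ^ (j + 1)" by (simp_all add: j)
  moreover have "coprime (2 ^ n) c" for n using assms by simp
  ultimately have "coprime (4 * g) c" "coprime (2 * g) c" by metis+
  then show "4 * g dvd x * c \<longleftrightarrow> 4 * g dvd x" "2 * g dvd x * c \<longleftrightarrow> 2 * g dvd x"
    by (simp_all add: coprime_dvd_mult_left_iff)
qed

text \<open>This is the kernel of the substitution in \<open>sqmon_translate\<close>, with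
  \<open>c\<close> and \<open>d\<close> standing for lq and lr. Modulo 2g the matrix is diagonal
  with odd entries, so 2g divides \<open>x\<close> and \<open>y\<close>. Then all terms with the
  factor 2g vanish modulo 4g, and the argument repeats there.\<close>

lemma unit_determinant:
  assumes "4 * g dvd x * (1 + 2 * p + 2 * g * c) + y * (2 * g * d)"
    and "4 * g dvd x * (2 * g * c) + y * (1 + 2 * s + 2 * g * d)"
  shows "4 * g dvd x \<and> 4 * g dvd y"
proof -
  from assms obtain u v where uv:
    "x * (1 + 2 * p + 2 * g * c) + y * (2 * g * d) = 4 * g * u"
    "x * (2 * g * c) + y * (1 + 2 * s + 2 * g * d) = 4 * g * v"
    by (auto elim!: dvdE)
  have "x * (1 + 2 * p) = 2 * g * (2 * u - x * c - y * d)" "y * (1 + 2 * s) = 2 * g * (2 * v - x * c - y * d)"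
    using uv by algebra+
  then have "2 * g dvd x" "2 * g dvd y"
    using dvd_mult_odd_iff(2)[of "1 + 2 * p" x] dvd_mult_odd_iff(2)[of "1 + 2 * s" y] by simp_all
  then obtain x' y' where xy: "x = 2 * g * x'" "y = 2 * g * y'" by (auto elim!: dvdE)
  have "x * (1 + 2 * p) = 4 * g * (u - g * x' * c - g * y' * d)"
    "y * (1 + 2 * s) = 4 * g * (v - g * x' * c - g * y' * d)"
    using uv xy by algebra+
  then show ?thesis
    using dvd_mult_odd_iff(1)[of "1 + 2 * p" x] dvd_mult_odd_iff(1)[of "1 + 2 * s" y] by simp
qed

lemma not_dvd_2: "\<not> (4 * g dvd x \<and> 4 * g dvd x - 2)" "\<not> 4 * g dvd 2"
proof -
  show "\<not> 4 * g dvd 2" using g_pos zdvd_imp_le[of "4 * g" 2] by auto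
  then show "\<not> (4 * g dvd x \<and> 4 * g dvd x - 2)"
    using dvd_diff[of "4 * g" x "x - 2"] by auto
qed

section \<open>Normal forms and the characteristic subgroup N\<close>

lemma carrier_cases:
  assumes "z \<in> carrier G"
  obtains (N) x y where "z = E x y" | (a) x y where "z = a \<otimes> E x y"
    | (b) x y where "z = b \<otimes> E x y" | (ab) x y where "z = a \<otimes> (b \<otimes> E x y)"
proof -
  define S where "S = {u. \<exists>x y. u = E x y \<or> u = a \<otimes> E x y \<or> u = b \<otimes> E x y \<or> u = a \<otimes> (b \<otimes> E x y)}"
  have S: "u \<in> S \<longleftrightarrow> (\<exists>x y. u = E x y \<or> u = a \<otimes> E x y \<or> u = b \<otimes> E x y \<or> u = a \<otimes> (b \<otimes> E x y))" for u
    by (simp add: S_def)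
  have ES: "E x y \<otimes> u \<in> S" if "u \<in> S" for x y u
    using that unfolding S by (elim exE disjE; simp add: collect; blast)
  have aS: "a \<otimes> u \<in> S" if "u \<in> S" for u
    using that unfolding S by (elim exE disjE; simp add: collect; blast)
  have bS: "b \<otimes> u \<in> S" if "u \<in> S" for u
    using that unfolding S by (elim exE disjE; simp add: collect; blast)
  have closed: "u \<in> carrier G" if "u \<in> S" for u
    using that unfolding S by auto
  \<comment> \<open>Inverse letters reduce to positive ones, since a^(-1) = a^(-2) a.\<close>
  have ia: "inv a = E (-1) 0 \<otimes> a" and ib: "inv b = E 0 (-1) \<otimes> b"
    by (rule inv_equality; simp add: m_assoc aa bb E_mult)+
  have "carrier G \<subseteq> S"
  proof (rule generated)
    have "\<one> = E 0 0" by simp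
    then show "\<one> \<in> S" unfolding S by blast
    show "a \<otimes> x \<in> S \<and> inv a \<otimes> x \<in> S \<and> b \<otimes> x \<in> S \<and> inv b \<otimes> x \<in> S" if x: "x \<in> S" for x
      using aS[OF x] bS[OF x] ES[OF aS[OF x]] ES[OF bS[OF x]] closed[OF x] by (simp add: ia ib m_assoc)
  qed
  then show ?thesis using assms S[of z] that by blast
qed

lemma E_eq_iff: "E x y = E x' y' \<longleftrightarrow> 4 * g dvd x - x' \<and> 4 * g dvd y - y'"
proof
  assume "E x y = E x' y'"
  then have "E x y \<otimes> E (- x') (- y') = E x' y' \<otimes> E (- x') (- y')" by simp
  then show "4 * g dvd x - x' \<and> 4 * g dvd y - y'" using E_eq_one[of "x - x'" "y - y'"] by (simp add: E_mult)
qed (blast intro: E_cong)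

lemma square_in_N:
  assumes "z \<in> carrier G" shows "\<exists>x y. z \<otimes> z = E x y"
  using assms by (cases rule: carrier_cases) (simp_all add: collect, blast+)

text \<open>Squares lie in N, which is abelian. Outside N, elements of aN fail to commute with b^2,
  and those of bN and abN with a^2: each inverts that square up to z^l.\<close>

lemma commutes_with_squares_iff:
  assumes "z \<in> carrier G"
  shows "(\<forall>w\<in>carrier G. z \<otimes> (w \<otimes> w) = w \<otimes> w \<otimes> z) \<longleftrightarrow> (\<exists>x y. z = E x y)"
    (is "?C \<longleftrightarrow> ?N")
proof
  assume ?N
  then obtain x y where z: "z = E x y" by blast
  show ?C
  proof
    fix w assume "w \<in> carrier G"
    then obtain x' y' where "w \<otimes> w = E x' y'" using square_in_N by blast
    then show "z \<otimes> (w \<otimes> w) = w \<otimes> w \<otimes> z" by (simp only: z E_commute)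
  qed
next
  assume ?C
  then have C: "z \<otimes> E 1 0 = E 1 0 \<otimes> z" "z \<otimes> E 0 1 = E 0 1 \<otimes> z"
    using aa bb by (metis a_closed, metis b_closed)
  from assms show ?N
  proof (cases rule: carrier_cases)
    case (a x y)
    \<comment> \<open>Comparing exponents would make both 2gl and 2gl - 2 multiples of 4g, hence
      also 2, although 4g is at least 4.\<close>
    then have "E x (y + 1) = E (2 * g * l + x) (2 * g * l - 1 + y)" using C(2) by (simp add: collect)
    then have "4 * g dvd 2 * g * l \<and> 4 * g dvd 2 * g * l - 2"
      using E_eq_iff[of "2 * g * l + x" "2 * g * l - 1 + y" x "y + 1"] by simp
    then show ?thesis using not_dvd_2(1) by blast
  next
    case (b x y)
    then have "E (x + 1) y = E (2 * g * l - 1 + x) (2 * g * l + y)" using C(1) by (simp add: collect)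
    then have "4 * g dvd 2 * g * l \<and> 4 * g dvd 2 * g * l - 2"
      using E_eq_iff[of "2 * g * l - 1 + x" "2 * g * l + y" "x + 1" y] by simp
    then show ?thesis using not_dvd_2(1) by blast
  next
    case (ab x y)
    then have "E (x + 1) y = E (2 * g * l - 1 + x) (2 * g * l + y)" using C(1) by (simp add: collect)
    then have "4 * g dvd 2 * g * l \<and> 4 * g dvd 2 * g * l - 2"
      using E_eq_iff[of "2 * g * l - 1 + x" "2 * g * l + y" "x + 1" y] by simp
    then show ?thesis using not_dvd_2(1) by blast
  qed blast
qed

lemma auto_N_iff:
  assumes \<phi>: "\<phi> \<in> auto G" and z: "z \<in> carrier G"
  shows "(\<exists>x y. \<phi> z = E x y) \<longleftrightarrow> (\<exists>x y. z = E x y)"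
proof -
  have hom: "\<phi> \<in> hom G G" and bij: "bij_betw \<phi> (carrier G) (carrier G)"
    using \<phi> by (auto simp: auto_def Bij_def)
  have "(\<forall>w\<in>carrier G. \<phi> z \<otimes> (w \<otimes> w) = w \<otimes> w \<otimes> \<phi> z) \<longleftrightarrow>
      (\<forall>w\<in>carrier G. \<phi> z \<otimes> (\<phi> w \<otimes> \<phi> w) = \<phi> w \<otimes> \<phi> w \<otimes> \<phi> z)"
    \<comment> \<open>By surjectivity, quantifying over the group is quantifying over the image of
      \<phi>.\<close>
    by (subst bij_betw_imp_surj_on[OF bij, symmetric]) simp
  also have "\<dots> \<longleftrightarrow> (\<forall>w\<in>carrier G. \<phi> (z \<otimes> (w \<otimes> w)) = \<phi> (w \<otimes> w \<otimes> z))"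
    using z by (simp add: hom_mult[OF hom])
  also have "\<dots> \<longleftrightarrow> (\<forall>w\<in>carrier G. z \<otimes> (w \<otimes> w) = w \<otimes> w \<otimes> z)"
    using z by (intro ball_cong HOL.refl inj_on_eq_iff[OF bij_betw_imp_inj_on[OF bij]]) auto
  finally show ?thesis
    using commutes_with_squares_iff[of z] commutes_with_squares_iff[of "\<phi> z"] z hom_in_carrier[OF hom z] by simp
qed

text \<open>The images of \<open>a\<close>, \<open>b\<close> and \<open>a \<otimes> b\<close> avoid
  N. The fourth powers of \<open>a\<close> and \<open>b\<close> are nontrivial while those in abN
  are trivial, so both images lie in aN or bN; in the same coset their product would fall into
  N.\<close>

lemma auto_cases:
  assumes \<phi>: "\<phi> \<in> auto G"
  obtains (keep) p q r s where "\<phi> a = a \<otimes> E p q" "\<phi> b = b \<otimes> E r s"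
    | (exchange) p q r s where "\<phi> a = b \<otimes> E p q" "\<phi> b = a \<otimes> E r s"
proof -
  have hom: "\<phi> \<in> hom G G" and bij: "bij_betw \<phi> (carrier G) (carrier G)"
    using \<phi> by (auto simp: auto_def Bij_def)
  interpret group_hom G G \<phi> using hom by unfold_locales
  have inj: "\<phi> u = \<phi> v \<longleftrightarrow> u = v" if "u \<in> carrier G" "v \<in> carrier G" for u v
    using that by (intro inj_on_eq_iff[OF bij_betw_imp_inj_on[OF bij]])
  have N: "\<phi> a \<noteq> E x y" "\<phi> b \<noteq> E x y" "\<phi> a \<otimes> \<phi> b \<noteq> E x y" for x y
    using auto_N_iff[OF \<phi>, of a] auto_N_iff[OF \<phi>, of b] auto_N_iff[OF \<phi>, of "a \<otimes> b"]
      a_neq_E b_neq_E ab_neq_E by auto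
  have ab4: "w \<otimes> w \<otimes> (w \<otimes> w) = \<one>" if "w = a \<otimes> (b \<otimes> E x y)" for w x y
    unfolding that by (simp add: collect) (rule E_one; algebra)
  have "a \<otimes> a \<otimes> (a \<otimes> a) \<noteq> \<one>" "b \<otimes> b \<otimes> (b \<otimes> b) \<noteq> \<one>"
    using E_eq_one[of 2 0] E_eq_one[of 0 2] not_dvd_2(2) by (auto simp: aa bb E_mult)
  then have o: "\<phi> a \<otimes> \<phi> a \<otimes> (\<phi> a \<otimes> \<phi> a) \<noteq> \<one>" "\<phi> b \<otimes> \<phi> b \<otimes> (\<phi> b \<otimes> \<phi> b) \<noteq> \<one>"
    using inj[of "a \<otimes> a \<otimes> (a \<otimes> a)" \<one>] inj[of "b \<otimes> b \<otimes> (b \<otimes> b)" \<one>] by simp_all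
  have "(\<exists>p q. \<phi> a = a \<otimes> E p q) \<or> (\<exists>p q. \<phi> a = b \<otimes> E p q)"
    using hom_closed[OF a_closed] o(1) N(1) by (cases rule: carrier_cases) (auto simp: ab4)
  moreover have "(\<exists>p q. \<phi> b = a \<otimes> E p q) \<or> (\<exists>p q. \<phi> b = b \<otimes> E p q)"
    using hom_closed[OF b_closed] o(2) N(2) by (cases rule: carrier_cases) (auto simp: ab4)
  moreover have False if "\<phi> a = a \<otimes> E p q" "\<phi> b = a \<otimes> E r s" for p q r s
    using N(3) by (simp add: that collect) blast
  moreover have False if "\<phi> a = b \<otimes> E p q" "\<phi> b = b \<otimes> E r s" for p q r s
    using N(3) by (simp add: that collect) blast
  ultimately show ?thesis using that by metis
qed

section \<open>Constructing automorphisms from images of the generators\<close>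

lemma hom_eqI:
  assumes "\<phi> \<in> hom G G" "\<psi> \<in> hom G G" "\<phi> a = \<psi> a" "\<phi> b = \<psi> b" "z \<in> carrier G"
  shows "\<phi> z = \<psi> z"
proof -
  have E: "\<phi> (E x y) = \<psi> (E x y)" for x y
    using assms by (simp add: hom_sqmon[OF is_group is_group])
  from assms(5) show ?thesis
    by (cases rule: carrier_cases)
      (simp_all add: hom_mult[OF assms(1)] hom_mult[OF assms(2)] E assms(3,4))
qed

text \<open>Members of \<open>auto G\<close> are extensional, so agreement on the carrier is
  equality.\<close>

lemma auto_eqI:
  assumes "\<phi> \<in> auto G" "\<psi> \<in> auto G" "\<phi> a = \<psi> a" "\<phi> b = \<psi> b"
  shows "\<phi> = \<psi>"
  using assms hom_eqI[of \<phi> \<psi>]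
  by (intro extensionalityI[of _ "carrier G"]) (auto simp: auto_def Bij_def)

lemma finite_carrier: "finite (carrier G)"
proof -
  define J where "J = case_prod E ` ({0..<4 * g} \<times> {0..<4 * g})"
  have J: "E x y \<in> J" for x y
  proof -
    have "E x y = E (x mod (4 * g)) (y mod (4 * g))"
      by (rule E_cong) (simp_all add: minus_mod_eq_mult_div)
    then show ?thesis using g_pos by (force simp: J_def)
  qed
  have "carrier G \<subseteq> J \<union> (\<otimes>) a ` J \<union> (\<otimes>) b ` J \<union> (\<lambda>u. a \<otimes> (b \<otimes> u)) ` J"
    using J by (blast elim: carrier_cases)
  moreover have "finite J" by (simp add: J_def)
  ultimately show ?thesis by (auto intro: finite_subset)
qed

text \<open>An injective endomorphism of a finite group is surjective; the restriction supplies the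
  extensionality that \<open>auto\<close> requires.\<close>

lemma injective_hom_auto:
  assumes "\<phi> \<in> hom G G" "inj_on \<phi> (carrier G)"
  shows "restrict \<phi> (carrier G) \<in> auto G"
proof -
  have "\<phi> ` carrier G = carrier G"
    using assms hom_in_carrier[OF assms(1)]
    by (intro endo_inj_surj[OF finite_carrier]) auto
  then have "bij_betw \<phi> (carrier G) (carrier G)" using assms by (simp add: bij_betw_def)
  then show ?thesis
    using assms(1) by (auto simp: auto_def Bij_def hom_def bij_betw_restrict_eq)
qed

text \<open>The universal property gives the endomorphism. It maps each of the four cosets of N into
  itself, so its kernel lies in N, where \<open>unit_determinant\<close> shows it to be
  trivial.\<close>

lemma exists_translation:
  assumes "even (l * (p + q + r + s))"
  shows "\<exists>\<phi>\<in>auto G. \<phi> a = a \<otimes> E p q \<and> \<phi> b = b \<otimes> E r s"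
proof -
  obtain \<phi> where hom: "\<phi> \<in> hom G G" and ab: "\<phi> a = a \<otimes> E p q" "\<phi> b = b \<otimes> E r s"
    using extends[OF translate_pair[OF HOL.refl HOL.refl assms]] by blast
  interpret group_hom G G \<phi> using hom by unfold_locales
  have E: "\<phi> (E x y) = sqmon G (a \<otimes> E p q) (b \<otimes> E r s) x y" for x y
    using hom_sqmon[OF is_group is_group hom a_closed b_closed] by (simp add: ab)
  note E' = E[unfolded sqmon_translate[OF HOL.refl HOL.refl]]
  have c: "c \<otimes> E x y \<noteq> \<one>" if "\<And>x y. c \<noteq> E x y" "c \<in> carrier G" for c x y
  proof
    assume "c \<otimes> E x y = \<one>"
    then have "inv E x y = c" using that(2) by (intro inv_equality) auto
    then show False using that(1) E_inv by metis
  qed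
  have "z = \<one>" if "z \<in> carrier G" "\<phi> z = \<one>" for z
    using that(1)
  proof (cases rule: carrier_cases)
    case (N x y)
    then have "4 * g dvd x \<and> 4 * g dvd y"
      using that(2) E_eq_one
      by (intro unit_determinant[of x p "l * q" y "l * r" s]) (auto simp: E' mult.assoc)
    then show ?thesis using N E_one by blast
  next
    case (a x y)
    then have "\<exists>i j. a \<otimes> E i j = \<one>" using that(2) by (simp add: ab E' collect, blast)
    then show ?thesis using c[OF a_neq_E] by blast
  next
    case (b x y)
    then have "\<exists>i j. b \<otimes> E i j = \<one>" using that(2) by (simp add: ab E' collect, blast)
    then show ?thesis using c[OF b_neq_E] by blast
  next
    case (ab x y)
    then have "\<exists>i j. a \<otimes> b \<otimes> E i j = \<one>" using that(2)
      by (simp add: ab(1) \<open>\<phi> a = _\<close> \<open>\<phi> b = _\<close> E' collect, blast)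
    then show ?thesis using c[OF ab_neq_E] by blast
  qed
  then have "inj_on \<phi> (carrier G)" by (simp add: inj_on_one_iff)
  then show ?thesis
    using injective_hom_auto[OF hom] ab by (intro bexI[of _ "restrict \<phi> (carrier G)"]) simp_all
qed

end

section \<open>Counting the admissible exponents\<close>

definition shift_params :: "int \<Rightarrow> int \<Rightarrow> (int \<times> int \<times> int \<times> int) set" where
  "shift_params m l = {(p, q, r, s). {p, q, r, s} \<subseteq> {0..<m} \<and> even (l * (p + q + r + s))}"

text \<open>For even \<open>l\<close> the whole box is admissible. For odd \<open>l\<close>,
  exchanging each even last coordinate with its successor is an involution of the box that reverses
  the parity of the sum; evenness of \<open>m\<close> keeps it inside the box.\<close>

lemma card_shift_params:
  assumes "even m" "0 \<le> m"
  shows "even l \<Longrightarrow> card (shift_params m l) = nat m ^ 4"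
    and "odd l \<Longrightarrow> 2 * card (shift_params m l) = nat m ^ 4"
proof -
  let ?Q = "{0..<m} \<times> {0..<m} \<times> {0..<m} \<times> {0..<m}"
  have Q: "card ?Q = nat m ^ 4" by (simp add: card_cartesian_product power4_eq_xxxx)
  show "card (shift_params m l) = nat m ^ 4" if "even l"
  proof -
    have "shift_params m l = ?Q" using that by (auto simp: shift_params_def)
    then show ?thesis by (simp only: Q)
  qed
  show "2 * card (shift_params m l) = nat m ^ 4" if l: "odd l"
  proof -
    let ?T = "shift_params m l"
    define f :: "int \<times> int \<times> int \<times> int \<Rightarrow> _"
      where "f = (\<lambda>(p, q, r, s). (p, q, r, if even s then s + 1 else s - 1))"
    have sub: "?T \<subseteq> ?Q" by (auto simp: shift_params_def)
    have lt: "s + 1 < m" if "even s" "s < m" for s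
      using that \<open>even m\<close> by presburger
    have gt: "0 \<le> s - 1" if "odd s" "0 \<le> s" for s :: int
      using that by presburger
    have mem: "(p, q, r, s) \<in> ?T \<longleftrightarrow> (p, q, r, s) \<in> ?Q \<and> even (p + q + r + s)" for p q r s
      using l by (auto simp: shift_params_def)
    have ff: "f (f z) = z" for z by (cases z) (simp add: f_def)
    have fQ: "f z \<in> ?Q" if "z \<in> ?Q" for z
    proof -
      obtain p q r s where z: "z = (p, q, r, s)" by (cases z)
      show ?thesis
        using that lt[of s] gt[of s] unfolding z f_def by (cases "even s") simp_all
    qed
    have fT: "f z \<in> ?T \<longleftrightarrow> z \<notin> ?T" if "z \<in> ?Q" for z
    proof -
      obtain p q r s where z: "z = (p, q, r, s)" by (cases z)
      obtain s' where s': "f z = (p, q, r, s')" "even s' \<longleftrightarrow> odd s" by (simp add: z f_def)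
      then show ?thesis using that fQ[OF that] unfolding z s'(1)[unfolded z] mem by simp
    qed
    have "bij_betw f ?T (?Q - ?T)"
    proof (rule bij_betw_byWitness[where f' = f])
      show "f ` ?T \<subseteq> ?Q - ?T" "f ` (?Q - ?T) \<subseteq> ?T"
        using sub by (intro image_subsetI DiffI fQ; simp only: fT[OF subsetD] fT DiffD1 DiffD2; blast)+
    qed (rule ballI, rule ff)+
    then have "card ?T = card (?Q - ?T)" by (rule bij_betw_same_card)
    also have "\<dots> = card ?Q - card ?T" by (intro card_Diff_subset finite_subset[OF sub] sub) simp_all
    moreover have "card ?T \<le> card ?Q" by (intro card_mono sub) simp
    ultimately show ?thesis using Q by linarith
  qed
qed

section \<open>Counting the automorphisms\<close>

context G2_group
begin

text \<open>The endomorphism exchanging the generators squares to the identity on them, hence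
  everywhere, and so is injective.\<close>

lemma exists_swap: "\<exists>\<sigma>\<in>auto G. \<sigma> a = b \<and> \<sigma> b = a"
proof -
  obtain \<sigma> where hom: "\<sigma> \<in> hom G G" and ab: "\<sigma> a = b" "\<sigma> b = a"
    using extends[OF swap] by blast
  have "\<sigma> (\<sigma> z) = z" if "z \<in> carrier G" for z
    using hom_eqI[of "\<lambda>z. \<sigma> (\<sigma> z)" "\<lambda>z. z" z] hom ab that by (auto simp: hom_def Pi_def)
  then have "inj_on \<sigma> (carrier G)" by (rule inj_on_inverseI)
  then show ?thesis
    using injective_hom_auto[OF hom] ab by (intro bexI[of _ "restrict \<sigma> (carrier G)"]) simp_all
qed

lemma compose_auto:
  assumes "\<phi> \<in> auto G" "\<psi> \<in> auto G" shows "compose (carrier G) \<phi> \<psi> \<in> auto G"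
  using subgroup.m_closed[OF subgroup_auto assms] assms by (simp add: BijGroup_def auto_def)

text \<open>If aN met bN, then \<open>a\<close> would lie in bN and \<open>a \<otimes> b\<close> in
  bNb, which is contained in N.\<close>

lemma a_coset_neq_b_coset: "a \<otimes> E p q \<noteq> b \<otimes> E r s"
proof
  assume eq: "a \<otimes> E p q = b \<otimes> E r s"
  have "a = a \<otimes> E p q \<otimes> E (- p) (- q)" by (simp add: m_assoc E_mult)
  also have "\<dots> = b \<otimes> E (r - p) (s - q)" by (simp add: eq m_assoc E_mult)
  finally have a: "a = b \<otimes> E (r - p) (s - q)" .
  show False
  proof -
    have "b \<otimes> E (r - p) (s - q) \<otimes> b = E (2 * g * l * (r - p) - (r - p)) (1 + (s - q + 2 * g * l * (r - p)))"
      by (simp add: collect)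
    then show False using ab_neq_E a by metis
  qed
qed

text \<open>Admissible exponents come from automorphisms by \<open>exists_translation\<close>.
  Conversely the images of \<open>a\<close> and \<open>b\<close> satisfy the relations, so
  \<open>BA_relation\<close> forces the parity.\<close>

lemma card_translation_autos:
  "bij_betw (\<lambda>(p, q, r, s). (a \<otimes> E p q, b \<otimes> E r s)) (shift_params (4 * g) l)
     ((\<lambda>\<phi>. (\<phi> a, \<phi> b)) ` {\<phi> \<in> auto G. \<exists>p q. \<phi> a = a \<otimes> E p q})"
  (is "bij_betw ?F ?T (?ev ` ?X)")
  unfolding bij_betw_def
proof
  show "inj_on ?F ?T"
  proof (rule inj_onI)
    have eq: "x = x'" if "4 * g dvd x - x'" "x \<in> {0..<4 * g}" "x' \<in> {0..<4 * g}" for x x'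
      using that by (metis atLeastLessThan_iff mod_eq_dvd_iff mod_pos_pos_trivial)
    fix z z' assume "z \<in> ?T" "z' \<in> ?T" "?F z = ?F z'"
    moreover obtain p q r s p' q' r' s' where "z = (p, q, r, s)" "z' = (p', q', r', s')"
      by (cases z, cases z')
    ultimately show "z = z'"
      using eq[of p p'] eq[of q q'] eq[of r r'] eq[of s s'] by (simp add: shift_params_def E_eq_iff)
  qed
  show "?F ` ?T = ?ev ` ?X"
  proof (intro equalityI subsetI)
    fix z assume "z \<in> ?F ` ?T"
    then obtain p q r s where z: "z = (a \<otimes> E p q, b \<otimes> E r s)" and "even (l * (p + q + r + s))"
      by (auto simp: shift_params_def)
    then obtain \<phi> where "\<phi> \<in> auto G" "\<phi> a = a \<otimes> E p q" "\<phi> b = b \<otimes> E r s"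
      using exists_translation by blast
    then show "z \<in> ?ev ` ?X" by (intro image_eqI[of _ _ \<phi>]) (auto simp: z)
  next
    fix z assume "z \<in> ?ev ` ?X"
    then obtain \<phi> p q where \<phi>: "\<phi> \<in> auto G" "z = (\<phi> a, \<phi> b)" and a: "\<phi> a = a \<otimes> E p q"
      by blast
    from \<phi>(1) obtain r s where b: "\<phi> b = b \<otimes> E r s"
    proof (cases rule: auto_cases)
      case (exchange p' q' r s)
      then show ?thesis using a a_coset_neq_b_coset by simp
    qed (use that in blast)
    interpret \<phi>: G2_pair G "\<phi> a" "\<phi> b" g k l
      using \<phi>(1) by (intro G2_pair_hom[OF G2_pair_axioms is_group]) (simp add: auto_def)
    have "E (2 * g * l * (p + q + r + s)) (2 * g * l * (p + q + r + s)) = \<one>"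
      using BA_relation[OF a b] \<phi>.b_a by simp
    then obtain c where "2 * g * l * (p + q + r + s) = 4 * g * c"
      using E_eq_one by (blast elim: dvdE)
    then have "2 * g * (l * (p + q + r + s)) = 2 * g * (2 * c)" by (simp only: mult.assoc)
    then have "l * (p + q + r + s) = 2 * c" using g_pos by simp
    then have ev: "even (l * (p + q + r + s))" by (metis dvd_triv_left)
    \<comment> \<open>Reduction into the box keeps the elements, and keeps parities because 4g is
      even.\<close>
    let ?r = "\<lambda>x. x mod (4 * g)"
    have par: "even (?r x) \<longleftrightarrow> even x" for x
      by (simp add: dvd_mod_iff)
    have "a \<otimes> E p q = a \<otimes> E (?r p) (?r q)" "b \<otimes> E r s = b \<otimes> E (?r r) (?r s)"
      by (simp_all add: E_eq_iff minus_mod_eq_mult_div)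
    moreover have "(?r p, ?r q, ?r r, ?r s) \<in> ?T"
      using ev g_pos by (simp add: shift_params_def par)
    ultimately show "z \<in> ?F ` ?T"
      by (intro image_eqI[of _ _ "(?r p, ?r q, ?r r, ?r s)"]) (simp_all add: \<phi> a b)
  qed
qed

text \<open>Composing with the exchange \<sigma> first is an involution that matches the
  automorphisms fixing aN and bN with those exchanging them, whence the factor 2.\<close>

theorem card_auto: "card (auto G) = 2 * card (shift_params (4 * g) l)"
proof -
  let ?X = "{\<phi> \<in> auto G. \<exists>p q. \<phi> a = a \<otimes> E p q}" and ?Y = "{\<phi> \<in> auto G. \<exists>p q. \<phi> a = b \<otimes> E p q}"
  have "inj_on (\<lambda>\<phi>. (\<phi> a, \<phi> b)) ?X" by (rule inj_onI) (auto intro: auto_eqI)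
  then have "bij_betw (\<lambda>\<phi>. (\<phi> a, \<phi> b)) ?X ((\<lambda>\<phi>. (\<phi> a, \<phi> b)) ` ?X)" by (simp add: bij_betw_def)
  with card_translation_autos have T: "card (shift_params (4 * g) l) = card ?X"
    by (metis (no_types, lifting) bij_betw_same_card)
  have "finite (shift_params (4 * g) l)"
    by (rule finite_subset[of _ "{0..<4*g} \<times> {0..<4*g} \<times> {0..<4*g} \<times> {0..<4*g}"]) (auto simp: shift_params_def)
  then have X: "finite ?X"
    using card_translation_autos \<open>bij_betw _ ?X _\<close> by (metis (no_types, lifting) bij_betw_finite)
  obtain \<sigma> where \<sigma>: "\<sigma> \<in> auto G" "\<sigma> a = b" "\<sigma> b = a" using exists_swap by blast
  let ?t = "\<lambda>\<phi>. compose (carrier G) \<phi> \<sigma>"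
  have t: "?t \<phi> \<in> auto G" "?t \<phi> a = \<phi> b" "?t \<phi> b = \<phi> a" if "\<phi> \<in> auto G" for \<phi>
    using that \<sigma> by (simp_all add: compose_auto) (simp_all add: compose_def)
  have tt: "?t (?t \<phi>) = \<phi>" if "\<phi> \<in> auto G" for \<phi>
    using that by (intro auto_eqI t) (simp_all add: t)
  have XY: "\<exists>r s. \<phi> b = b \<otimes> E r s" if "\<phi> \<in> auto G" "\<phi> a = a \<otimes> E p q" for \<phi> p q
    using that(1)
  proof (cases rule: auto_cases)
    case (exchange p' q' r s)
    then show ?thesis using that(2) a_coset_neq_b_coset by simp
  qed blast
  have YX: "\<exists>r s. \<phi> b = a \<otimes> E r s" if "\<phi> \<in> auto G" "\<phi> a = b \<otimes> E p q" for \<phi> p q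
    using that(1)
  proof (cases rule: auto_cases)
    case (keep p' q' r s)
    then show ?thesis using that(2) a_coset_neq_b_coset[of p' q' p q] by simp
  qed blast
  have "bij_betw ?t ?X ?Y"
  proof (rule bij_betw_byWitness[where f' = ?t])
    show "?t ` ?X \<subseteq> ?Y" "?t ` ?Y \<subseteq> ?X"
      using XY YX by (auto simp: t)
  qed (simp_all add: tt)
  then have Y: "card ?Y = card ?X" "finite ?Y"
    using X bij_betw_same_card[of ?t ?X ?Y] bij_betw_finite[of ?t ?X ?Y] by simp_all
  have "(\<exists>p q. \<phi> a = a \<otimes> E p q) \<or> (\<exists>p q. \<phi> a = b \<otimes> E p q)" if "\<phi> \<in> auto G" for \<phi>
    using that by (rule auto_cases) blast+
  then have "auto G = ?X \<union> ?Y" by blast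
  moreover have "?X \<inter> ?Y = {}"
    using a_coset_neq_b_coset a_coset_neq_b_coset[symmetric] by auto
  ultimately have "card (auto G) = card ?X + card ?Y"
    using card_Un_disjoint[OF X Y(2)] by simp
  then show ?thesis using T Y by simp
qed

end

section \<open>Independence of the squares\<close>

text \<open>The state \<open>(s, t, x, y)\<close> stands for \<open>a\<^sup>s b\<^sup>t a\<^sup>2\<^sup>x b\<^sup>2\<^sup>y\<close>; a letter acts on it by right
  multiplication.\<close>

type_synonym state = "bool \<times> bool \<times> int \<times> int"

text \<open>Exponents stay integers and are compared modulo \<open>m\<close>, so the checks on the
  action are polynomial identities over the integers.\<close>

definition state_cong :: "int \<Rightarrow> state \<Rightarrow> state \<Rightarrow> bool" where
  "state_cong m = (\<lambda>(s, t, x, y) (s', t', x', y'). s = s' \<and> t = t' \<and> m dvd x - x' \<and> m dvd y - y')"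

context
  fixes g k l :: int
begin

text \<open>The normal form of a^s b^t a^(2x) b^(2y) times a letter, obtained from the rules of
  \<open>E_a\<close>, \<open>E_b\<close> and \<open>b_a\<close>. A negative letter is the positive
  one followed by its inverse square, hence the subtracted 1.\<close>

fun step :: "state \<Rightarrow> gen \<times> bool \<Rightarrow> state" where
  "step (s, t, x, y) (gen_a, pos) =
    (\<not> s, t,
     x + 2 * g * l * y + (if t then 2 * g * k + (if s then 2 * g * l else 1) else if s then 1 else 0)
       - (if pos then 0 else 1),
     2 * g * l * y - y + (if t then 2 * g * k - 1 + (if s then 2 * g * l else 0) else 0))"
| "step (s, t, x, y) (gen_b, pos) =
    (s, \<not> t, 2 * g * l * x - x, y + 2 * g * l * x + (if t then 1 else 0) - (if pos then 0 else 1))"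

definition act :: "state \<Rightarrow> gen word \<Rightarrow> state" where
  "act = foldl step"

lemma act_simps [simp]: "act u [] = u" "act u (c # w) = act (step u c) w"
  by (simp_all add: act_def)

lemma act_append: "act u (v @ w) = act (act u v) w"
  by (simp add: act_def)

abbreviation state_eq :: "state \<Rightarrow> state \<Rightarrow> bool" (infix "\<approx>" 50) where
  "u \<approx> v \<equiv> state_cong (4 * g) u v"

lemma state_eq_refl: "u \<approx> u"
  by (auto simp: state_cong_def split: prod.split)

lemma state_eq_sym: "u \<approx> v \<Longrightarrow> v \<approx> u"
  by (auto simp: state_cong_def dvd_diff_commute split: prod.splits)

lemma state_eq_trans: "u \<approx> v \<Longrightarrow> v \<approx> w \<Longrightarrow> u \<approx> w"
  by (auto simp: state_cong_def split: prod.splits) (metis diff_add_cancel dvd_add add_diff_eq)+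

lemma step_cong: "u \<approx> v \<Longrightarrow> step u c \<approx> step v c"
proof -
  assume uv: "u \<approx> v"
  obtain s t x y where u: "u = (s, t, x, y)" by (cases u)
  with uv obtain x' y' where v: "v = (s, t, x', y')" and dvd: "4 * g dvd x - x'" "4 * g dvd y - y'"
    by (cases v) (auto simp: state_cong_def)
  from dvd obtain p q where xy: "x = x' + 4 * g * p" "y = y' + 4 * g * q"
    by (metis dvdE diff_eq_eq add.commute)
  show ?thesis
  proof (cases c)
    case (Pair d pos)
    have "step u (gen_a, pos) \<approx> step v (gen_a, pos)" "step u (gen_b, pos) \<approx> step v (gen_b, pos)"
      unfolding u v xy by (simp_all add: state_cong_def) (intro conjI; algebra)+
    then show ?thesis unfolding Pair by (cases d) simp_all
  qed
qed

lemma act_cong: "u \<approx> v \<Longrightarrow> act u w \<approx> act v w"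
  by (induction w arbitrary: u v) (simp_all add: step_cong)

text \<open>The correction terms cancel up to multiples of 4g, which is why the action is considered
  modulo \<approx>.\<close>

lemma step_inverse: "step (step u (d, pos)) (d, \<not> pos) \<approx> u"
proof -
  obtain s t x y where u: "u = (s, t, x, y)" by (cases u)
  have "step (step u (gen_a, pos)) (gen_a, \<not> pos) \<approx> u" "step (step u (gen_b, pos)) (gen_b, \<not> pos) \<approx> u"
    unfolding u by (cases s; cases t; cases pos; simp add: state_cong_def; intro conjI; algebra)+
  then show ?thesis by (cases d) simp_all
qed

text \<open>This is how a word for the monomial with exponents \<open>i\<close>, \<open>j\<close>
  should act from the right: whatever the coset, only the exponents move.\<close>

definition shifts :: "gen word \<Rightarrow> int \<Rightarrow> int \<Rightarrow> bool" where
  "shifts w i j \<longleftrightarrow> (\<forall>s t x y. act (s, t, x, y) w \<approx> (s, t, x + i, y + j))"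

lemma shifts_append:
  assumes "shifts v i j" "shifts w i' j'"
  shows "shifts (v @ w) (i + i') (j + j')"
  unfolding shifts_def
proof (intro allI)
  fix s t x y
  have "act (act (s, t, x, y) v) w \<approx> act (s, t, x + i, y + j) w"
    using assms(1) by (intro act_cong) (simp add: shifts_def)
  moreover have "act (s, t, x + i, y + j) w \<approx> (s, t, x + (i + i'), y + (j + j'))"
    using assms(2) by (simp add: shifts_def add.assoc[symmetric])
  ultimately show "act (s, t, x, y) (v @ w) \<approx> (s, t, x + (i + i'), y + (j + j'))"
    unfolding act_append by (rule state_eq_trans)
qed

lemma shifts_Nil: "shifts [] 0 0"
  by (simp add: shifts_def state_eq_refl)

lemma shifts_pow: "shifts w i j \<Longrightarrow> shifts (word_pow w n) (int n * i) (int n * j)"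
proof (induction n)
  case (Suc n)
  then show ?case using shifts_append[of w i j "word_pow w n" "int n * i" "int n * j"]
    by (simp add: word_pow_def algebra_simps)
qed (simp add: word_pow_def shifts_Nil)

lemma shifts_squares:
  "shifts [(gen_a, True), (gen_a, True)] 1 0" "shifts [(gen_b, True), (gen_b, True)] 0 1"
  "shifts [(gen_a, False), (gen_a, False)] (-1) 0" "shifts [(gen_b, False), (gen_b, False)] 0 (-1)"
proof -
  have "act (s, t, x, y) [(gen_a, True), (gen_a, True)] \<approx> (s, t, x + 1, y)"
    "act (s, t, x, y) [(gen_b, True), (gen_b, True)] \<approx> (s, t, x, y + 1)"
    "act (s, t, x, y) [(gen_a, False), (gen_a, False)] \<approx> (s, t, x - 1, y)"
    "act (s, t, x, y) [(gen_b, False), (gen_b, False)] \<approx> (s, t, x, y - 1)" for s t x y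
    by (cases s; cases t; simp add: state_cong_def; (intro conjI)?; algebra)+
  then show "shifts [(gen_a, True), (gen_a, True)] 1 0" "shifts [(gen_b, True), (gen_b, True)] 0 1"
    "shifts [(gen_a, False), (gen_a, False)] (-1) 0" "shifts [(gen_b, False), (gen_b, False)] 0 (-1)"
    by (simp_all add: shifts_def)
qed

lemma shifts_eq:
  assumes "shifts v i j" "shifts w i' j'" "4 * g dvd i - i'" "4 * g dvd j - j'"
  shows "act u v \<approx> act u w"
proof -
  obtain s t x y where u: "u = (s, t, x, y)" by (cases u)
  have "act u v \<approx> (s, t, x + i, y + j)" "act u w \<approx> (s, t, x + i', y + j')"
    using assms(1,2) by (auto simp: shifts_def u)
  moreover have "(s, t, x + i, y + j) \<approx> (s, t, x + i', y + j')"
    using assms(3,4) by (simp add: state_cong_def)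
  ultimately show ?thesis by (meson state_eq_sym state_eq_trans)
qed

text \<open>The action respects free cancellation by \<open>step_inverse\<close>; once it respects
  the relations it descends to the presented group.\<close>

lemma pres_cong_act:
  assumes "pres_cong R v w" "\<And>v w u. (v, w) \<in> R \<Longrightarrow> act u v \<approx> act u w"
  shows "act u v \<approx> act u w"
  using assms(1)
proof (induction arbitrary: u)
  case (append v v' w w')
  then show ?case unfolding act_append by (meson act_cong state_eq_trans)
next
  case (cancel d pos)
  show ?case by (simp add: step_inverse)
qed (blast intro: assms(2) state_eq_refl state_eq_sym state_eq_trans)+

lemma word_pow_double: "word_pow [c] (2 * i) = word_pow [c, c] i"
  by (induction i) (simp_all add: word_pow_def)

lemma shifts_even_pow:
  "shifts (word_pow [(gen_a, True)] (2 * i)) (int i) 0"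
  "shifts (word_pow [(gen_b, True)] (2 * i)) 0 (int i)"
  using shifts_pow[OF shifts_squares(1), of i] shifts_pow[OF shifts_squares(2), of i]
  by (simp_all add: word_pow_double)

text \<open>Both sides of every relation are words for elements of N, so each acts as a shift, and
  it suffices to compare the two shifts modulo 4g.\<close>

lemma relations_act:
  assumes "e \<ge> 3" "g = 2 ^ (e - 3)" "k = int nk" "l = int nl"
    and vw: "(v, w) \<in> G2_relations e nk nl"
  shows "act u v \<approx> act u w"
proof -
  let ?a = "(gen_a, True)" and ?b = "(gen_b, True)" and ?a' = "(gen_a, False)" and ?b' = "(gen_b, False)"
  define N where "N = (2::nat) ^ (e - 3)"
  have n: "2 ^ e = 2 * (4 * N)" and g: "g = int N"
    using assms(1,2) power_add[of "2::nat" 3 "e - 3"] by (simp_all add: N_def)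
  define z where "z = word_pow [?a] (2 ^ e div 2) @ word_pow [?b] (2 ^ e div 2)"
  have "2 ^ e div 2 = 2 * (2 * N)" using n by simp
  then have z: "shifts z (2 * g) (2 * g)"
    unfolding z_def using shifts_append[OF shifts_even_pow(1)[of "2 * N"] shifts_even_pow(2)[of "2 * N"]] by (simp add: g)
  have "v = word_pow [?a] (2 ^ e) \<and> w = [] \<or> v = word_pow [?b] (2 ^ e) \<and> w = [] \<or>
    v = [?b', ?b', ?a', ?a', ?b, ?b, ?a, ?a] \<and> w = [] \<or>
    v = [?b', ?a', ?b, ?a] \<and> w = [?a, ?a] @ [?b', ?b'] @ word_pow z nk \<or>
    v = [?a', ?b, ?b, ?a] \<and> w = [?b', ?b'] @ word_pow z nl \<or>
    v = [?b', ?a, ?a, ?b] \<and> w = [?a', ?a'] @ word_pow z nl"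
    using vw by (simp add: G2_relations_def word_gen_def word_comm_def word_conj_def word_inv_def
        Let_def z_def numeral_2_eq_2 word_pow_def[of "[_]" "Suc (Suc 0)"])
  then show ?thesis
  proof (elim disjE conjE)
    assume "v = word_pow [?a] (2 ^ e)" "w = []"
    then show ?thesis using shifts_eq[OF shifts_even_pow(1)[of "4 * N"] shifts_Nil, of u] n g by simp
  next
    assume "v = word_pow [?b] (2 ^ e)" "w = []"
    then show ?thesis using shifts_eq[OF shifts_even_pow(2)[of "4 * N"] shifts_Nil, of u] n g by simp
  next
    assume *: "v = [?b', ?b', ?a', ?a', ?b, ?b, ?a, ?a]" "w = []"
    have "shifts v 0 0"
      using shifts_append[OF shifts_append[OF shifts_squares(4,3)] shifts_append[OF shifts_squares(2,1)]]
      by (simp add: *)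
    then show ?thesis unfolding *(2) by (rule shifts_eq[OF _ shifts_Nil]) simp_all
  next
    assume *: "v = [?b', ?a', ?b, ?a]" "w = [?a, ?a] @ [?b', ?b'] @ word_pow z nk"
    have v: "shifts v (1 + 2 * g * k) (2 * g * k - 1)"
    proof -
      have "act (s, t, x, y) [?b', ?a', ?b, ?a] \<approx> (s, t, x + (1 + 2 * g * k), y + (2 * g * k - 1))" for s t x y
        by (cases s; cases t; simp add: state_cong_def; (intro conjI)?; algebra)
      then show ?thesis by (simp add: shifts_def *)
    qed
    show ?thesis unfolding *(2)
      by (rule shifts_eq[OF v shifts_append[OF shifts_squares(1) shifts_append[OF shifts_squares(4) shifts_pow[OF z]]]])
        (simp_all add: assms)
  next
    assume *: "v = [?a', ?b, ?b, ?a]" "w = [?b', ?b'] @ word_pow z nl"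
    have v: "shifts v (2 * g * l) (2 * g * l - 1)"
    proof -
      have "act (s, t, x, y) [?a', ?b, ?b, ?a] \<approx> (s, t, x + (2 * g * l), y + (2 * g * l - 1))" for s t x y
        by (cases s; cases t; simp add: state_cong_def; (intro conjI)?; algebra)
      then show ?thesis by (simp add: shifts_def *)
    qed
    show ?thesis unfolding *(2)
      by (rule shifts_eq[OF v shifts_append[OF shifts_squares(4) shifts_pow[OF z]]])
        (simp_all add: assms)
  next
    assume *: "v = [?b', ?a, ?a, ?b]" "w = [?a', ?a'] @ word_pow z nl"
    have v: "shifts v (2 * g * l - 1) (2 * g * l)"
    proof -
      have "act (s, t, x, y) [?b', ?a, ?a, ?b] \<approx> (s, t, x + (2 * g * l - 1), y + (2 * g * l))" for s t x y
        by (cases s; cases t; simp add: state_cong_def; (intro conjI)?; algebra)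
      then show ?thesis by (simp add: shifts_def *)
    qed
    show ?thesis unfolding *(2)
      by (rule shifts_eq[OF v shifts_append[OF shifts_squares(3) shifts_pow[OF z]]])
        (simp_all add: assms)
  qed
qed

end

section \<open>The presented group\<close>

context group
begin

lemma word_eval_word_gen:
  assumes "\<And>x. f x \<in> carrier G" shows "word_eval G f (word_gen x) = f x"
  by (simp add: word_eval_def word_gen_def assms)

lemma word_eval_word_inv:
  assumes "\<And>x. f x \<in> carrier G" shows "word_eval G f (word_inv w) = inv word_eval G f w"
proof (rule inv_equality[symmetric])
  \<comment> \<open>Only free cancellation is involved, so the empty set of relations
    serves.\<close>
  have "word_eval G f (word_inv w @ w) = word_eval G f []"
    by (rule word_eval_pres_cong[of f "{}", OF assms]) (simp_all add: pres_cong_word_inv_left)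
  then show "word_eval G f (word_inv w) \<otimes> word_eval G f w = \<one>"
    unfolding word_eval_append[OF assms] by (simp add: word_eval_def)
qed (rule word_eval_closed[OF assms])+

lemma word_eval_word_pow:
  assumes "\<And>x. f x \<in> carrier G" shows "word_eval G f (word_pow w n) = word_eval G f w [^] n"
proof (induction n)
  case 0
  show ?case by (simp add: word_eval_def word_pow_def)
next
  case (Suc n)
  have "word_pow w (Suc n) = w @ word_pow w n" by (simp add: word_pow_def)
  then have "word_eval G f (word_pow w (Suc n)) = word_eval G f w \<otimes> word_eval G f w [^] n"
    by (simp only: word_eval_append[OF assms] Suc)
  then show ?case by (simp only: nat_pow_Suc2 word_eval_closed assms)
qed

lemma nat_pow_double: "x \<in> carrier G \<Longrightarrow> x [^] (2 * n) = (x \<otimes> x) [^] n" for n :: nat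
  using nat_pow_pow[of x 2 n] by (simp add: numeral_2_eq_2)

text \<open>The bridge between words and exponents. One direction shows that the generators form a
  pair; the other feeds an arbitrary pair into the universal property.\<close>

lemma word_eval_G2_relations:
  assumes e: "e \<ge> 3" and f: "\<And>x. f x \<in> carrier G"
  shows "(\<forall>(v, w)\<in>G2_relations e k l. word_eval G f v = word_eval G f w) \<longleftrightarrow>
    G2_pair G (f gen_a) (f gen_b) (2 ^ (e - 3)) (int k) (int l)"
proof -
  define a b where "a = f gen_a" and "b = f gen_b"
  have c [simp]: "a \<in> carrier G" "b \<in> carrier G" by (simp_all add: a_def b_def f)
  define N where "N = (2::nat) ^ (e - 3)"
  have n: "2 ^ e = 2 * (4 * N)" "2 * (4 * N) div 2 = 2 * (2 * N)"
    using e power_add[of "2::nat" 3 "e - 3"] by (simp_all add: N_def)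
  have g: "2 ^ (e - 3) = int N" by (simp add: N_def)
  define z where "z = (a \<otimes> a) [^] (2 * N) \<otimes> (b \<otimes> b) [^] (2 * N)"
  have sq: "x [^] (2::nat) = x \<otimes> x" if "x \<in> carrier G" for x
    using that by (simp add: numeral_2_eq_2)
  have Nil: "word_eval G f [] = \<one>" by (simp add: word_eval_def)
  have "(\<forall>(v, w)\<in>G2_relations e k l. word_eval G f v = word_eval G f w) \<longleftrightarrow>
      (a \<otimes> a) [^] (4 * N) = \<one> \<and> (b \<otimes> b) [^] (4 * N) = \<one> \<and>
      inv (b \<otimes> b) \<otimes> (inv (a \<otimes> a) \<otimes> (b \<otimes> b \<otimes> (a \<otimes> a))) = \<one> \<and>
      inv b \<otimes> (inv a \<otimes> (b \<otimes> a)) = a \<otimes> a \<otimes> (inv (b \<otimes> b) \<otimes> z [^] k) \<and>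
      inv a \<otimes> (b \<otimes> b \<otimes> a) = inv (b \<otimes> b) \<otimes> z [^] l \<and>
      inv b \<otimes> (a \<otimes> a \<otimes> b) = inv (a \<otimes> a) \<otimes> z [^] l"
    unfolding G2_relations_def Let_def n word_comm_def word_conj_def z_def
    by (simp only: ball_simps prod.case word_eval_append[OF f] word_eval_word_inv[OF f] word_eval_word_pow[OF f]
        word_eval_word_gen[OF f] Nil nat_pow_double[OF c(1)] nat_pow_double[OF c(2)] sq c simp_thms
        flip: a_def b_def)
  also have "\<dots> \<longleftrightarrow> G2_pair G a b (int N) (int k) (int l)" (is "?R \<longleftrightarrow> ?P")
  proof -
    have comm: "inv (b \<otimes> b) \<otimes> (inv (a \<otimes> a) \<otimes> (b \<otimes> b \<otimes> (a \<otimes> a))) = \<one> \<longleftrightarrow>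
        a \<otimes> a \<otimes> (b \<otimes> b) = b \<otimes> b \<otimes> (a \<otimes> a)"
      using inv_solve_left'[of \<one> "b \<otimes> b" "inv (a \<otimes> a) \<otimes> (b \<otimes> b \<otimes> (a \<otimes> a))"]
        inv_solve_left'[of "b \<otimes> b" "a \<otimes> a" "b \<otimes> b \<otimes> (a \<otimes> a)"] by auto
    show ?thesis
    \<comment> \<open>Monomials can be combined only if the squares commute; otherwise both sides
      are false.\<close>
    proof (cases "a \<otimes> a \<otimes> (b \<otimes> b) = b \<otimes> b \<otimes> (a \<otimes> a)")
      case True
      interpret commuting_squares G a b using True by unfold_locales simp_all
      have z: "z = E (2 * int N) (2 * int N)"
        by (simp add: z_def sqmon_def flip: int_pow_int)
      have zp: "z [^] i = E (2 * int N * int i) (2 * int N * int i)" for i :: nat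
        using E_pow[of "2 * int N" "2 * int N" "int i"] by (simp add: z int_pow_int)
      have p: "(a \<otimes> a) [^] (4 * N) = E (4 * int N) 0" "(b \<otimes> b) [^] (4 * N) = E 0 (4 * int N)"
        by (simp_all add: sqmon_def flip: int_pow_int)
      have E: "a \<otimes> a = E 1 0" "b \<otimes> b = E 0 1" by (simp_all add: aa bb)
      have "inv b \<otimes> (inv a \<otimes> (b \<otimes> a)) = a \<otimes> a \<otimes> (inv (b \<otimes> b) \<otimes> z [^] k) \<longleftrightarrow>
          b \<otimes> a = a \<otimes> b \<otimes> E (1 + 2 * int N * int k) (2 * int N * int k - 1)"
        unfolding zp E E_inv E_mult by (subst inv_solve_left'; simp add: m_assoc)+
      moreover have "inv a \<otimes> (b \<otimes> b \<otimes> a) = inv (b \<otimes> b) \<otimes> z [^] l \<longleftrightarrow>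
          b \<otimes> b \<otimes> a = a \<otimes> E (2 * int N * int l) (2 * int N * int l - 1)"
        unfolding zp E E_inv E_mult by (subst inv_solve_left'; simp add: m_assoc)
      moreover have "inv b \<otimes> (a \<otimes> a \<otimes> b) = inv (a \<otimes> a) \<otimes> z [^] l \<longleftrightarrow>
          a \<otimes> a \<otimes> b = b \<otimes> E (2 * int N * int l - 1) (2 * int N * int l)"
        unfolding zp E E_inv E_mult by (subst inv_solve_left'; simp add: m_assoc)
      ultimately show ?thesis
        by (simp only: p comm True simp_thms conj_assoc G2_pair_def G2_pair_axioms_def commuting_squares_axioms)
    next
      case False
      then show ?thesis
        by (simp only: comm G2_pair_def commuting_squares_def commuting_squares_axioms_def simp_thms)
    qed
  qed
  finally show ?thesis by (simp only: g a_def b_def)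
qed

end

lemma word_eval_presented_group:
  "word_eval (presented_group R) (\<lambda>x. pres_rel R `` {word_gen x}) w = pres_rel R `` {w}"
proof (induction w)
  case Nil
  show ?case by (simp add: word_eval_def presented_group_one)
next
  case (Cons c w)
  interpret group "presented_group R" by (rule group_presented_group)
  have inv: "inv\<^bsub>presented_group R\<^esub> (pres_rel R `` {[(x, True)]}) = pres_rel R `` {[(x, False)]}" for x
    using pres_cong.cancel[of R x False]
    by (intro inv_equality)
      (auto simp: presented_group_mult presented_group_one presented_group_carrier pres_class_eq_iff
        intro: pres_cong.refl)
  obtain x s where "c = (x, s)" by (cases c)
  then show ?case
    using Cons by (simp add: word_eval_def word_gen_def inv presented_group_mult)
qed

theorem G2_group_G2:
  assumes e: "e \<ge> 3"
  shows "G2_group (G2 e k l) (pres_rel (G2_relations e k l) `` {word_gen gen_a})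
    (pres_rel (G2_relations e k l) `` {word_gen gen_b}) (2 ^ (e - 3)) (int k) (int l)"
proof -
  define R where "R = G2_relations e k l"
  define cl where "cl w = pres_rel R `` {w}" for w
  define f where "f x = cl (word_gen x)" for x
  define g where "g = (2::int) ^ (e - 3)"
  define G where "G = presented_group R"
  interpret group G unfolding G_def by (rule group_presented_group)
  have f: "f x \<in> carrier G" for x
    by (auto simp: f_def cl_def G_def presented_group_carrier)
  have ev: "word_eval G f w = cl w" for w
    unfolding f_def cl_def G_def by (rule word_eval_presented_group)
  have "G2_pair G (f gen_a) (f gen_b) g (int k) (int l)"
    unfolding g_def
    by (rule iffD1[OF word_eval_G2_relations[OF e f]])
      (auto simp: ev cl_def pres_class_eq_iff simp flip: R_def intro: pres_cong.relation)
  then interpret G2_pair G "f gen_a" "f gen_b" g "int k" "int l" .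
  have act: "state_cong (4 * g) (act g (int k) (int l) u v) (act g (int k) (int l) u w)" if "cl v = cl w" for u v w
    using that pres_cong_act[of R v w g "int k" "int l" u] relations_act[OF e g_def HOL.refl HOL.refl]
    by (simp add: cl_def pres_class_eq_iff R_def)
  \<comment> \<open>Word powers take natural exponents, so \<open>x\<close> and \<open>y\<close> are
    first reduced modulo 4g; the word a^(2i) b^(2j) then acts as a known shift.\<close>
  have E_word: "\<exists>w i j. shifts g (int k) (int l) w i j \<and> cl w = E x y \<and> 4 * g dvd x - i \<and> 4 * g dvd y - j" for x y
  proof -
    define i j where "i = nat (x mod (4 * g))" and "j = nat (y mod (4 * g))"
    have ij: "int i = x mod (4 * g)" "int j = y mod (4 * g)"
      by (simp_all add: i_def j_def g_def)
    have "word_eval G f (word_pow (word_gen gen_a) (2 * i) @ word_pow (word_gen gen_b) (2 * j)) = E (int i) (int j)"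
      by (simp add: word_eval_append[OF f] word_eval_word_pow[OF f] word_eval_word_gen[OF f] nat_pow_double f
          sqmon_def int_pow_int)
    moreover have "E x y = E (int i) (int j)"
      by (rule E_cong) (simp_all add: ij minus_mod_eq_mult_div)
    moreover have "4 * g dvd x - int i" "4 * g dvd y - int j"
      by (simp_all add: ij minus_mod_eq_mult_div)
    ultimately show ?thesis
      using shifts_append[OF shifts_even_pow(1)[of g "int k" "int l" i] shifts_even_pow(2)[of g "int k" "int l" j]]
      by (auto simp: ev word_gen_def)
  qed
  have origin: "state_cong (4 * g) (act g (int k) (int l) (False, False, 0, 0) w) (False, False, i, j)"
    if "shifts g (int k) (int l) w i j" for w i j
    using that[unfolded shifts_def, rule_format, of False False 0 0] by simp
  \<comment> \<open>A word for a monomial takes the origin to a state with both flags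
    \<open>False\<close>, so a word that sets a flag represents an element outside N.\<close>
  have not_E: "cl v \<noteq> E x y" if "fst (act g (int k) (int l) (False, False, 0, 0) v) \<or>
      fst (snd (act g (int k) (int l) (False, False, 0, 0) v))" for v x y
  proof
    assume "cl v = E x y"
    moreover obtain w i j where w: "shifts g (int k) (int l) w i j" "cl w = E x y" using E_word by blast
    ultimately have "state_cong (4 * g) (act g (int k) (int l) (False, False, 0, 0) v)
        (act g (int k) (int l) (False, False, 0, 0) w)" by (intro act) simp
    moreover have "state_cong (4 * g) (act g (int k) (int l) (False, False, 0, 0) w) (False, False, i, j)"
      using w(1) by (rule origin)
    ultimately show False using that by (auto simp: state_cong_def split: prod.splits)
  qed
  have "G2_group G (f gen_a) (f gen_b) g (int k) (int l)"
  proof unfold_locales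
    show "\<exists>j. g = 2 ^ j" by (auto simp: g_def)
    show "carrier G \<subseteq> S" if "\<one>\<^bsub>G\<^esub> \<in> S"
      and S: "\<And>x. x \<in> S \<Longrightarrow> f gen_a \<otimes>\<^bsub>G\<^esub> x \<in> S \<and> inv\<^bsub>G\<^esub> f gen_a \<otimes>\<^bsub>G\<^esub> x \<in> S \<and>
        f gen_b \<otimes>\<^bsub>G\<^esub> x \<in> S \<and> inv\<^bsub>G\<^esub> f gen_b \<otimes>\<^bsub>G\<^esub> x \<in> S" for S
    proof
      have "word_eval G f w \<in> S" for w
      proof (induction w)
        case (Cons c w)
        obtain x s where "c = (x, s)" by (cases c)
        then show ?case using S[OF Cons] by (cases x) (auto simp: word_eval_def)
      qed (simp add: word_eval_def that(1))
      then show "X \<in> S" if "X \<in> carrier G" for X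
        using that unfolding ev by (auto simp: cl_def G_def presented_group_carrier)
    qed
    show "4 * g dvd x \<and> 4 * g dvd y" if E: "E x y = \<one>\<^bsub>G\<^esub>" for x y
    proof -
      \<comment> \<open>A word for a trivial monomial fixes the origin modulo 4g and also shifts it
        by \<open>i\<close> and \<open>j\<close>.\<close>
      obtain w i j where w: "shifts g (int k) (int l) w i j" "cl w = E x y" "4 * g dvd x - i" "4 * g dvd y - j"
        using E_word by blast
      have "cl w = cl []" unfolding w(2) E by (simp add: cl_def G_def presented_group_one)
      then have "state_cong (4 * g) (act g (int k) (int l) (False, False, 0, 0) w) (False, False, 0, 0)"
        using act[of w "[]" "(False, False, 0, 0)"] by simp
      moreover have "state_cong (4 * g) (act g (int k) (int l) (False, False, 0, 0) w) (False, False, i, j)"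
        using w(1) by (rule origin)
      ultimately have "state_cong (4 * g) (False, False, i, j) (False, False, 0, 0)"
        by (meson state_eq_sym state_eq_trans)
      then have "4 * g dvd i" "4 * g dvd j" by (simp_all add: state_cong_def)
      then show ?thesis using w(3,4) by (metis dvd_add diff_add_cancel)
    qed
    show "f gen_a \<noteq> E x y" "f gen_b \<noteq> E x y" for x y
      using not_E[of "word_gen gen_a"] not_E[of "word_gen gen_b"] by (simp_all add: f_def word_gen_def)
    show "f gen_a \<otimes>\<^bsub>G\<^esub> f gen_b \<noteq> E x y" for x y
      using not_E[of "word_gen gen_a @ word_gen gen_b" x y]
      by (simp add: f_def cl_def G_def presented_group_mult word_gen_def)
    show "\<exists>\<phi>\<in>hom G G. \<phi> (f gen_a) = a' \<and> \<phi> (f gen_b) = b'"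
      if pair: "G2_pair G a' b' g (int k) (int l)" for a' b'
    proof -
      define h where "h x = (case x of gen_a \<Rightarrow> a' | gen_b \<Rightarrow> b')" for x
      interpret p: G2_pair G a' b' g "int k" "int l" by fact
      have h: "h x \<in> carrier G" for x by (cases x) (simp_all add: h_def)
      have rel: "\<forall>(v, w)\<in>R. word_eval G h v = word_eval G h w"
        unfolding R_def by (rule iffD2[OF word_eval_G2_relations[OF e h]]) (use pair in \<open>simp add: h_def g_def\<close>)
      have "\<exists>\<phi>\<in>hom (presented_group R) G. \<forall>w. \<phi> (pres_rel R `` {w}) = word_eval G h w"
        by (rule presented_group_hom_exists[OF h]) (use rel in blast)
      then have "\<exists>\<phi>\<in>hom G G. \<forall>w. \<phi> (cl w) = word_eval G h w"
        by (simp only: G_def cl_def)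
      then obtain \<phi> where "\<phi> \<in> hom G G" "\<And>w. \<phi> (cl w) = word_eval G h w" by blast
      then show ?thesis
        by (intro bexI[of _ \<phi>]) (simp_all only: f_def word_eval_word_gen[OF h], simp_all add: h_def)
    qed
  qed
  then show ?thesis by (simp add: G_def f_def cl_def R_def g_def G2_def)
qed

theorem mainTheorem8:
  fixes e k l :: nat
  assumes "e \<ge> 3" and "k \<in> {0, 1}" and "l \<in> {0, 1}"
  shows "(l = 0 \<longrightarrow> order (AutoGroup (G2 e k l)) = 2 ^ (4 * e - 3)) \<and>
         (l = 1 \<longrightarrow> order (AutoGroup (G2 e k l)) = 2 ^ (4 * e - 4))"
proof -
  define m where "m = 4 * (2::int) ^ (e - 3)"
  have "order (AutoGroup (G2 e k l)) = card (auto (G2 e k l))"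
    by (simp add: order_def AutoGroup_def)
  also have "\<dots> = 2 * card (shift_params m (int l))"
    unfolding m_def by (rule G2_group.card_auto[OF G2_group_G2[OF assms(1)]])
  finally have card: "order (AutoGroup (G2 e k l)) = 2 * card (shift_params m (int l))" .
  obtain j where e: "e = 3 + j" using assms(1) le_Suc_ex by blast
  have "nat m = 2 ^ (2 + j)"
    by (simp add: m_def e power_add nat_mult_distrib nat_power_eq)
  \<comment> \<open>Here m = 4g = 2^(e-1), so the box of exponents has 2^(4e-4) points.\<close>
  then have m: "nat m ^ 4 = 2 ^ (4 * e - 4)"
    by (simp only: power_mult[symmetric]) (simp add: e algebra_simps)
  have "even m" "0 \<le> m" by (simp_all add: m_def)
  note params = card_shift_params[OF this, of "int l"]
  \<comment> \<open>For \<open>l = 0\<close> the factor 2 from the exchange raises the exponent by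
    one; for \<open>l = 1\<close> it is absorbed by the halving under the parity condition.\<close>
  have "4 * e - 3 = Suc (4 * e - 4)" by (simp add: e)
  then show ?thesis
    using card params m by auto
qed

end
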